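(* The Virasoro algebra $\mathbf{Vir}$ over $\mathbb{C}$ does not admit a nontrivial transposed $\delta$-Poisson structure for any $\delta\in\mathbb{C}$.
   Context: All algebras are over $\mathbb{C}$. The Virasoro algebra $\mathbf{Vir}$ is the Lie algebra with basis $\{L_i,C\}_{i\in\mathbb{Z}}$, where $C$ is central and $[L_i,L_j]=(i-j)L_{i+j}+(i^3-i)\delta_{i+j,0}C$ ($\delta_{i+j,0}$ is the Kronecker delta). For fixed $\delta\in\mathbb{C}$, a transposed $\delta$-Poisson algebra $(\mathrm{P},\cdot,[\cdot,\cdot])$ consists of a commutative associative algebra $(\mathrm{P},\cdot)$ and a Lie algebra $(\mathrm{P},[\cdot,\cdot])$ on the same space satisfying $x\cdot[y,z]=\delta\big([x\cdot y,z]+[y,x\cdot z]\big)$ for all $x,y,z$. A Lie algebra $(\mathfrak{L},[\cdot,\cdot])$ has a nontrivial transposed $\delta$-Poisson structure $\cdot$ if $(\mathfrak{L},\cdot,[\cdot,\cdot])$ is a transposed $\delta$-Poisson algebra with both multiplications nonzero. *)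

theory Defs
  imports Complex_Main "HOL-Library.Poly_Mapping"
begin

locale complex_algebra =
  vector_space scale
  for scale :: "complex \<Rightarrow> 'a::ab_group_add \<Rightarrow> 'a" +
  fixes mult :: "'a \<Rightarrow> 'a \<Rightarrow> 'a"
  assumes linear_right: "\<And>x. Vector_Spaces.linear scale scale (\<lambda>y. mult x y)"
    and linear_left: "\<And>y. Vector_Spaces.linear scale scale (\<lambda>x. mult x y)"

(* no unit is required *)
locale comm_assoc_algebra = complex_algebra +
  assumes mult_assoc: "\<And>x y z. mult (mult x y) z = mult x (mult y z)"
    and mult_commute: "\<And>x y. mult x y = mult y x"

locale lie_algebra = complex_algebra scale bracket
  for scale :: "complex \<Rightarrow> 'a::ab_group_add \<Rightarrow> 'a" and bracket :: "'a \<Rightarrow> 'a \<Rightarrow> 'a" +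
  assumes alternating: "\<And>x. bracket x x = 0"
    and jacobi: "\<And>x y z. bracket x (bracket y z) + bracket y (bracket z x)
                   + bracket z (bracket x y) = 0"

locale transposed_poisson_algebra =
  comm_assoc_algebra scale mult + lie: lie_algebra scale bracket
  for \<delta> :: complex and scale :: "complex \<Rightarrow> 'a::ab_group_add \<Rightarrow> 'a"
    and mult :: "'a \<Rightarrow> 'a \<Rightarrow> 'a" and bracket :: "'a \<Rightarrow> 'a \<Rightarrow> 'a" +
  assumes transposed_leibniz: "\<And>x y z. mult x (bracket y z)
            = scale \<delta> (bracket (mult x y) z + bracket y (mult x z))"

definition nontrivial_transposed_poisson_structure ::
  "complex \<Rightarrow> (complex \<Rightarrow> 'a::ab_group_add \<Rightarrow> 'a) \<Rightarrow> ('a \<Rightarrow> 'a \<Rightarrow> 'a) \<Rightarrow> ('a \<Rightarrow> 'a \<Rightarrow> 'a) \<Rightarrow> bool"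
  where "nontrivial_transposed_poisson_structure \<delta> scale bracket mult \<longleftrightarrow>
    transposed_poisson_algebra \<delta> scale mult bracket \<and>
    (\<exists>x y. mult x y \<noteq> 0) \<and> (\<exists>x y. bracket x y \<noteq> 0)"

(* The Virasoro algebra is the free complex vector space on the index type below,
   i.e. the finitely supported functions from it to the complex numbers. *)
datatype vir_index = Ind_L int | Ind_C

type_synonym vir = "vir_index \<Rightarrow>\<^sub>0 complex"

definition vir_scale :: "complex \<Rightarrow> vir \<Rightarrow> vir"
  where "vir_scale c = Poly_Mapping.map ((*) c)"

definition vir_basis :: "vir_index \<Rightarrow> vir"
  where "vir_basis i = Poly_Mapping.single i 1"

abbreviation vir_L :: "int \<Rightarrow> vir"
  where "vir_L i \<equiv> vir_basis (Ind_L i)"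

abbreviation vir_C :: vir
  where "vir_C \<equiv> vir_basis Ind_C"

fun vir_basis_bracket :: "vir_index \<Rightarrow> vir_index \<Rightarrow> vir"
  where
    "vir_basis_bracket (Ind_L i) (Ind_L j) = vir_scale (of_int (i - j)) (vir_L (i + j))
       + vir_scale (if i + j = 0 then of_int (i ^ 3 - i) else 0) vir_C"
  | "vir_basis_bracket Ind_C _ = 0"
  | "vir_basis_bracket _ Ind_C = 0"

definition vir_bracket :: "vir \<Rightarrow> vir \<Rightarrow> vir"
  where "vir_bracket x y =
    (\<Sum>i\<in>Poly_Mapping.keys x. \<Sum>j\<in>Poly_Mapping.keys y.
       vir_scale (Poly_Mapping.lookup x i * Poly_Mapping.lookup y j) (vir_basis_bracket i j))"

lemma lookup_vir_scale [simp]: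
  "Poly_Mapping.lookup (vir_scale c x) k = c * Poly_Mapping.lookup x k"
  unfolding vir_scale_def by transfer (simp add: when_def)

interpretation vir: vector_space vir_scale
  by unfold_locales (simp_all add: poly_mapping_eq_iff fun_eq_iff lookup_add algebra_simps)

lemma vir_expand:
  "x = (\<Sum>k\<in>Poly_Mapping.keys x. vir_scale (Poly_Mapping.lookup x k) (vir_basis k))"
  by (rule poly_mapping_eqI)
    (simp add: lookup_sum vir_basis_def lookup_single when_def in_keys_iff if_distrib cong: if_cong)

lemma inj_vir_basis: "inj vir_basis"
  by (rule injI) (metis lookup_single_eq lookup_single_not_eq one_neq_zero vir_basis_def)

lemma span_vir_basis: "vir.span (range vir_basis) = UNIV"
proof -
  have "x \<in> vir.span (range vir_basis)" for x
    by (subst vir_expand) (intro vir.span_sum vir.span_scale vir.span_base rangeI)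
  then show ?thesis by blast
qed

lemma independent_vir_basis: "vir.independent (range vir_basis)"
  unfolding vir.independent_explicit_module
proof (intro allI impI)
  fix t u v
  assume t: "finite t" "t \<subseteq> range vir_basis"
    and zero: "(\<Sum>w\<in>t. vir_scale (u w) w) = 0" and v: "v \<in> t"
  obtain k where k: "v = vir_basis k" using t(2) v by auto
  have "Poly_Mapping.lookup w k = (if w = v then 1 else 0)" if w: "w \<in> t" for w
  proof -
    obtain l where "w = vir_basis l" using t(2) w by auto
    moreover from this have "w = v \<longleftrightarrow> l = k" using inj_vir_basis by (simp add: k inj_eq)
    ultimately show ?thesis by (simp add: vir_basis_def lookup_single)
  qed
  then have "Poly_Mapping.lookup (\<Sum>w\<in>t. vir_scale (u w) w) k = (\<Sum>w\<in>t. if w = v then u w else 0)"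
    by (auto simp: lookup_sum intro!: sum.cong)
  then show "u v = 0" using zero t(1) v by simp
qed

lemma vir_bracket_add_left: "vir_bracket (x + x') y = vir_bracket x y + vir_bracket x' y"
  unfolding vir_bracket_def
  by (rule setsum_keys_plus_distrib
      [where f = "\<lambda>i c. \<Sum>j\<in>Poly_Mapping.keys y.
         vir_scale (c * Poly_Mapping.lookup y j) (vir_basis_bracket i j)"])
    (simp_all add: algebra_simps sum.distrib vir.scale_left_distrib)

lemma vir_bracket_add_right: "vir_bracket x (y + y') = vir_bracket x y + vir_bracket x y'"
  unfolding vir_bracket_def sum.distrib[symmetric]
  by (rule sum.cong[OF refl], rule setsum_keys_plus_distrib
      [where f = "\<lambda>j c. vir_scale (Poly_Mapping.lookup x i * c) (vir_basis_bracket i j)" for i])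
    (simp_all add: algebra_simps vir.scale_left_distrib)

lemma keys_vir_scale: "c \<noteq> 0 \<Longrightarrow> Poly_Mapping.keys (vir_scale c x) = Poly_Mapping.keys x"
  by (auto simp: in_keys_iff)

lemma vir_bracket_scale_left: "vir_bracket (vir_scale c x) y = vir_scale c (vir_bracket x y)"
  by (cases "c = 0")
    (simp_all add: vir_bracket_def keys_vir_scale vir.scale_sum_right mult.assoc)

lemma vir_bracket_scale_right: "vir_bracket x (vir_scale c y) = vir_scale c (vir_bracket x y)"
  by (cases "c = 0")
    (simp_all add: vir_bracket_def keys_vir_scale vir.scale_sum_right mult.left_commute)

lemma vir_bracket_basis: "vir_bracket (vir_basis i) (vir_basis j) = vir_basis_bracket i j"
  by (simp add: vir_bracket_def vir_basis_def)

lemma vir_bracket_L_L: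
  "vir_bracket (vir_L i) (vir_L j) = vir_scale (of_int (i - j)) (vir_L (i + j))
     + vir_scale (if i + j = 0 then of_int (i ^ 3 - i) else 0) vir_C"
  by (simp add: vir_bracket_basis)

interpretation vir: complex_algebra vir_scale vir_bracket
  by unfold_locales
    (simp_all add: vir_bracket_add_left vir_bracket_add_right
      vir_bracket_scale_left vir_bracket_scale_right)

lemma vir_bracket_0 [simp]: "vir_bracket 0 x = 0" "vir_bracket x 0 = 0"
  by (simp_all add: vir_bracket_def)

lemma vir_induct [case_names zero add scale basis]:
  assumes "P 0" "\<And>x y. P x \<Longrightarrow> P y \<Longrightarrow> P (x + y)" "\<And>c x. P x \<Longrightarrow> P (vir_scale c x)"
    "\<And>k. P (vir_basis k)"
  shows "P x"
proof -
  have "x \<in> vir.span (range vir_basis)" by (simp add: span_vir_basis)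
  then show ?thesis
    by (induction rule: vir.span_induct_alt) (use assms in auto)
qed

lemma vir_basis_bracket_antisym: "vir_basis_bracket i j = - vir_basis_bracket j i"
  by (cases i; cases j)
    (auto simp: poly_mapping_eq_iff fun_eq_iff lookup_add algebra_simps power3_eq_cube
      add_eq_0_iff)

lemma vir_bracket_antisym: "vir_bracket x y = - vir_bracket y x"
proof (induction x rule: vir_induct)
  case (basis k)
  show ?case
  proof (induction y rule: vir_induct)
    case (basis l)
    show ?case by (simp add: vir_bracket_basis vir_basis_bracket_antisym[of k])
  qed (simp_all add: vir_bracket_add_left vir_bracket_add_right
      vir_bracket_scale_left vir_bracket_scale_right)
qed (simp_all add: vir_bracket_add_left vir_bracket_add_right
      vir_bracket_scale_left vir_bracket_scale_right)

lemma vir_bracket_alternating: "vir_bracket x x = 0"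
proof -
  have "vir_bracket x x + vir_bracket x x = 0"
    using vir_bracket_antisym[of x x] by (simp add: eq_neg_iff_add_eq_0)
  then show ?thesis
    by (simp add: poly_mapping_eq_iff fun_eq_iff lookup_add)
qed

lemma vir_bracket_C [simp]: "vir_bracket vir_C x = 0" "vir_bracket x vir_C = 0"
proof -
  show 1: "vir_bracket vir_C x = 0" for x
    by (induction x rule: vir_induct)
      (simp_all add: vir_bracket_basis vir_bracket_add_right vir_bracket_scale_right)
  show "vir_bracket x vir_C = 0" using vir_bracket_antisym[of x] 1 by simp
qed

lemma vir_jacobi_L:
  "vir_bracket (vir_L i) (vir_bracket (vir_L j) (vir_L k))
   + vir_bracket (vir_L j) (vir_bracket (vir_L k) (vir_L i))
   + vir_bracket (vir_L k) (vir_bracket (vir_L i) (vir_L j)) = 0"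
proof -
  have nested: "vir_bracket (vir_L i) (vir_bracket (vir_L j) (vir_L k)) =
    vir_scale (of_int ((j - k) * (i - (j + k)))) (vir_L (i + j + k)) +
    vir_scale (if i + j + k = 0 then of_int ((j - k) * (i ^ 3 - i)) else 0) vir_C" for i j k
    by (simp add: vir_bracket_L_L vir_bracket_add_right vir_bracket_scale_right
        vir.scale_right_distrib add.assoc)
  have L: "(j - k) * (i - (j + k)) + (k - i) * (j - (k + i)) + (i - j) * (k - (i + j)) = 0"
    by algebra
  have C: "(j - k) * (i ^ 3 - i) + (k - i) * (j ^ 3 - j) + (i - j) * (k ^ 3 - k) = 0"
    if "i + j + k = 0"
    using that by algebra
  let ?a = "\<lambda>i j k. vir_scale (of_int ((j - k) * (i - (j + k)))) (vir_L (i + j + k))"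
  let ?b = "\<lambda>i j k. vir_scale (if i + j + k = 0 then of_int ((j - k) * (i ^ 3 - i)) else 0) vir_C"
  have idx: "j + k + i = i + j + k" "k + i + j = i + j + k" by simp_all
  have "?a i j k + ?a j k i + ?a k i j = 0"
    unfolding idx vir.scale_left_distrib[symmetric] of_int_add[symmetric] L by simp
  moreover have "?b i j k + ?b j k i + ?b k i j = 0"
  proof (cases "i + j + k = 0")
    case True
    then show ?thesis
      unfolding idx if_P[OF True] vir.scale_left_distrib[symmetric] of_int_add[symmetric] C[OF True]
      by simp
  qed (simp add: idx)
  ultimately show ?thesis
    unfolding nested by (metis (no_types, lifting) add.commute add.left_commute add_0)
qed

lemma vir_jacobi:
  "vir_bracket x (vir_bracket y z) + vir_bracket y (vir_bracket z x)
   + vir_bracket z (vir_bracket x y) = 0" (is "?J x y z = 0")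
proof -
  note bilinear = vir_bracket_add_left vir_bracket_add_right
    vir_bracket_scale_left vir_bracket_scale_right
  have scale: "?J (vir_scale c x) y z = vir_scale c (?J x y z)" for c x y z
    by (simp add: bilinear vir.scale_right_distrib)
  have add: "?J (x + x') y z = ?J x y z + ?J x' y z" for x x' y z
    by (simp add: bilinear algebra_simps)
  have cyc: "?J x y z = ?J y z x" for x y z
    by (simp add: algebra_simps)
  have basis: "?J (vir_basis i) (vir_basis j) (vir_basis k) = 0" for i j k
    by (cases i; cases j; cases k) (simp_all add: vir_jacobi_L)
  have 1: "?J x (vir_basis j) (vir_basis k) = 0" for x j k
    by (induction x rule: vir_induct) (simp_all only: scale add basis, simp_all)
  have 2: "?J y (vir_basis k) x = 0" for x y k
  proof (induction y rule: vir_induct)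
    case (basis l)
    show ?case using 1[of x l k] cyc by metis
  qed (simp_all only: scale add, simp_all)
  have "?J z x y = 0"
  proof (induction z rule: vir_induct)
    case (basis k)
    show ?case using 2[of y k x] cyc by metis
  qed (simp_all only: scale add, simp_all)
  then show ?thesis using cyc by metis
qed

interpretation vir: lie_algebra vir_scale vir_bracket
  by unfold_locales (fact vir_bracket_alternating vir_jacobi)+

end

theory Submission
  imports Defs
begin

text \<open>
  Multiplication by a fixed element is a \<open>\<delta>\<close>-derivation: a linear map \<open>\<phi>\<close> with
  \<open>\<phi> [y, z] = \<delta> ([\<phi> y, z] + [y, \<phi> z])\<close>. Splitting \<open>\<phi>\<close> into its homogeneous components, the
  component of degree \<open>k\<close> is a function \<open>f\<close> on the integers satisfying
  \<open>(i - j) f (i + j) = \<delta> ((i - j + k) f i + (i - j - k) f j)\<close>. Comparing \<open>f i\<close>, \<open>f (- i)\<close> and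
  \<open>f 0\<close> gives \<open>f = 0\<close> unless \<open>\<delta>\<close> is \<open>1/2\<close>, \<open>1\<close> (or \<open>0\<close>, which is excluded because the
  Virasoro algebra is perfect). For \<open>\<delta> = 1/2\<close> the map \<open>f\<close> is constant, and the central cocycle
  kills all components of nonzero degree, so \<open>\<phi>\<close> is a scalar; for \<open>\<delta> = 1\<close> the map \<open>f\<close> is a
  multiple of \<open>k - i\<close>, as for an inner derivation. In both cases commutativity of the
  multiplication forces it to vanish.
\<close>

section \<open>The functional equation of a homogeneous component\<close>

locale homogeneous_component =
  fixes \<delta> :: complex and k :: int and f :: "int \<Rightarrow> complex"
  assumes eq: "\<And>i j. of_int (i - j) * f (i + j)
      = \<delta> * (of_int (i - j + k) * f i + of_int (i - j - k) * f j)"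
begin

lemma eq_0: "((1 - \<delta>) * of_int i - \<delta> * of_int k) * f i = \<delta> * of_int (i - k) * f 0"
  using eq[of i 0] by (simp add: algebra_simps)

text \<open>Eliminate \<open>f 1\<close> and \<open>f (- 1)\<close> from \<open>eq_0\<close> at 1
  and -1 and \<open>eq\<close> at (1, -1); \<open>k\<close> cancels.\<close>

lemma at_0_eq: "(1 - \<delta>) * (2 * \<delta> - 1) * (\<delta> + 1) * f 0 = 0"
proof -
  define K where "K = (of_int k :: complex)"
  have 1: "((1 - \<delta>) - \<delta> * K) * f 1 = \<delta> * (1 - K) * f 0"
    using eq_0[of 1] by (simp add: K_def)
  have 2: "(- (1 - \<delta>) - \<delta> * K) * f (- 1) = \<delta> * (- 1 - K) * f 0"
    using eq_0[of "- 1"] by (simp add: K_def)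
  have 3: "2 * f 0 = \<delta> * ((2 + K) * f 1 + (2 - K) * f (- 1))"
    using eq[of 1 "- 1"] by (simp add: K_def)
  define P where "P = (1 - \<delta>) - \<delta> * K"
  define N where "N = - (1 - \<delta>) - \<delta> * K"
  \<comment> \<open>Multiplying through avoids dividing by \<open>P\<close> or \<open>N\<close>,
    either of which may vanish.\<close>
  have "2 * f 0 * (P * N) = \<delta> * ((2 + K) * (P * f 1) * N + (2 - K) * (N * f (- 1)) * P)"
    unfolding 3 by (simp add: algebra_simps)
  also have "\<dots> = \<delta> * ((2 + K) * (\<delta> * (1 - K) * f 0) * N + (2 - K) * (\<delta> * (- 1 - K) * f 0) * P)"
    using 1 2 by (simp add: P_def N_def)
  finally show ?thesis unfolding P_def N_def by algebra
qed

lemma eq_zero: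
  assumes "\<delta> \<noteq> 1" "\<delta> \<noteq> 1 / 2"
  shows "f i = 0"
proof -
  have "f 0 = 0"
  \<comment> \<open>At \<delta> = -1 \<open>at_0_eq\<close> is void, so further indices are
    compared: 1, 2, 3 if \<open>k\<close> is 0, and the multiples \<open>k\<close>,
    \<open>2 * k\<close>, \<open>3 * k\<close> otherwise.\<close>
  proof (cases "\<delta> = - 1")
    case True
    define K where "K = (of_int k :: complex)"
    show ?thesis
    proof (cases "k = 0")
      case k: True
      have "2 * f 1 = - f 0" "2 * f 2 = - f 0"
        using eq_0[of 1] eq_0[of 2] by (simp_all add: True k)
      moreover have "2 * f 3 = - f 0"
        using eq_0[of 3] by (simp add: True k)
      moreover have "f 3 = - (f 2 + f 1)"
        using eq[of 2 1] by (simp add: True k)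
      ultimately show ?thesis by algebra
    next
      case False
      then have K: "K \<noteq> 0" by (simp add: K_def)
      have "3 * K * f k = 0"
        using eq_0[of k] by (simp add: True K_def algebra_simps)
      then have fk: "f k = 0" using K by simp
      have "K * (5 * f (2 * k)) = K * (- f 0)"
        using eq_0[of "2 * k"] by (simp add: True K_def algebra_simps)
      then have f2: "5 * f (2 * k) = - f 0" using K by (simp only: mult_cancel_left) simp
      have "K * (7 * f (3 * k)) = K * (- 2 * f 0)"
        using eq_0[of "3 * k"] by (simp add: True K_def algebra_simps)
      then have f3: "7 * f (3 * k) = - 2 * f 0" using K by (simp only: mult_cancel_left) simp
      have "K * (- f (3 * k)) = K * (2 * f (2 * k))"
        using eq[of k "2 * k"] by (simp add: True K_def fk)
      then have "- f (3 * k) = 2 * f (2 * k)" using K by (simp only: mult_cancel_left) simp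
      with f2 f3 show ?thesis by algebra
    qed
  next
    case False
    then have "\<delta> + 1 \<noteq> 0" by (simp add: add_eq_0_iff2)
    moreover have "1 - \<delta> \<noteq> 0" "2 * \<delta> - 1 \<noteq> 0" using assms by (auto simp: field_simps)
    ultimately show ?thesis using at_0_eq by simp
  qed
  then have D: "((1 - \<delta>) * of_int i - \<delta> * of_int k) * f i = 0" for i
    using eq_0[of i] by simp
  \<comment> \<open>the first factor vanishes for at most one \<open>i\<close>\<close>
  have off: "f j = 0" if "f i \<noteq> 0" "j \<noteq> i" for i j
  proof (rule ccontr)
    assume "f j \<noteq> 0"
    then have "(1 - \<delta>) * of_int j = \<delta> * of_int k" "(1 - \<delta>) * of_int i = \<delta> * of_int k"
      using D[of i] D[of j] that by simp_all
    then have "(1 - \<delta>) * of_int j = (1 - \<delta>) * of_int i" by simp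
    with assms(1) that show False by simp
  qed
  show ?thesis
  proof (rule ccontr)
    assume i: "f i \<noteq> 0"
    with \<open>f 0 = 0\<close> have "i \<noteq> 0" by auto
    then have "f (2 * i) = 0" "f (- i) = 0" using off[OF i] by auto
    then show False using eq[of "2 * i" "- i"] i \<open>i \<noteq> 0\<close> by simp
  qed
qed

lemma const_of_half:
  assumes "\<delta> = 1 / 2"
  shows "f i = f 0"
proof -
  have off: "f i = f 0" if "i \<noteq> k" for i
  proof -
    have "2 * ((of_int i - of_int k) * f i) = 2 * ((of_int i - of_int k) * f 0)"
      using eq_0[of i] by (simp add: assms field_simps)
    with that show ?thesis by simp
  qed
  show ?thesis
  proof (cases "i = k \<and> k \<noteq> 0")
    case True
    \<comment> \<open>\<open>eq_0\<close> is empty at \<open>i = k\<close>; the pair (2k, -k) has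
      sum \<open>k\<close> and avoids that index.\<close>
    then have "f (2 * k) = f 0" "f (- k) = f 0" using off[of "2 * k"] off[of "- k"] by simp_all
    then have "of_int k * (3 * f k) = of_int k * (3 * f 0)"
      using eq[of "2 * k" "- k"] by (simp add: assms algebra_simps)
    with True show ?thesis by simp
  next
    case False
    then show ?thesis using off[of i] by auto
  qed
qed

lemma inner_of_one:
  assumes "\<delta> = 1"
  shows "\<exists>u. \<forall>i. f i = of_int (k - i) * u"
proof (cases "k = 0")
  case False
  have "f i = of_int (k - i) * (f 0 / of_int k)" for i
    using eq_0[of i] False by (simp add: assms field_simps)
  then show ?thesis by blast
next
  case True
  have f0: "f 0 = 0" using eq_0[of 1] by (simp add: assms True)
  have add: "f (i + j) = f i + f j" if "i \<noteq> j" for i j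
  proof -
    have "of_int (i - j) * f (i + j) = of_int (i - j) * (f i + f j)"
      using eq[of i j] by (simp only: assms True ring_distribs) simp
    with that show ?thesis by simp
  qed
  \<comment> \<open>The pair (1, 1) is excluded from \<open>add\<close>; instead \<open>f 5\<close>
    is computed as both 4 + 1 and 3 + 2.\<close>
  have f2: "f 2 = 2 * f 1"
    using add[of 3 1] add[of 4 1] add[of 3 2] by simp
  have step: "f (i + 1) = f i + f 1" for i
    using add[of i 1] f2 by (cases "i = 1") auto
  have lin: "f i = of_int i * f 1" for i
  proof (induction i rule: int_induct[of _ 0])
    case (step2 i)
    then show ?case using step[of "i - 1"] by (simp add: algebra_simps)
  qed (simp_all add: f0 step algebra_simps)
  have "f i = of_int (k - i) * (- f 1)" for i by (simp add: True lin[of i])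
  then show ?thesis by blast
qed

end

section \<open>Coordinates of the Virasoro bracket\<close>

lemma lookup_vir_basis: "Poly_Mapping.lookup (vir_basis k) l = (if k = l then 1 else 0)"
  by (simp add: vir_basis_def lookup_single when_def)

lemma lookup_bracket_L:
  "Poly_Mapping.lookup (vir_bracket x (vir_L j)) (Ind_L n)
    = of_int (n - 2 * j) * Poly_Mapping.lookup x (Ind_L (n - j))"
proof (induction x rule: vir_induct)
  case (basis l)
  show ?case
    by (cases l) (auto simp: vir_bracket_basis lookup_add lookup_vir_basis)
qed (simp_all only: vir_bracket_add_left vir_bracket_scale_left vir_bracket_0 lookup_zero
    lookup_add lookup_vir_scale distrib_left mult.left_commute mult_zero_right)

lemma lookup_bracket_C:
  "Poly_Mapping.lookup (vir_bracket x (vir_L j)) Ind_C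
    = - of_int (j ^ 3 - j) * Poly_Mapping.lookup x (Ind_L (- j))"
proof (induction x rule: vir_induct)
  case (basis l)
  show ?case
    by (cases l)
      (auto simp: vir_bracket_basis lookup_add lookup_vir_basis add_eq_0_iff2)
qed (simp_all only: vir_bracket_add_left vir_bracket_scale_left vir_bracket_0 lookup_zero
    lookup_add lookup_vir_scale distrib_left mult.left_commute mult_zero_right)

lemma vir_eqI:
  assumes "\<And>n. Poly_Mapping.lookup x (Ind_L n) = Poly_Mapping.lookup y (Ind_L n)"
    and "Poly_Mapping.lookup x Ind_C = Poly_Mapping.lookup y Ind_C"
  shows "x = y"
  by (rule poly_mapping_eqI) (metis assms vir_index.exhaust)

section \<open>Derivations up to a scalar\<close>

locale vir_delta_derivation =
  fixes \<delta> :: complex and \<phi> :: "vir \<Rightarrow> vir"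
  assumes nonzero: "\<delta> \<noteq> 0"
    and linear: "Vector_Spaces.linear vir_scale vir_scale \<phi>"
    and leibniz: "\<And>y z. \<phi> (vir_bracket y z)
      = vir_scale \<delta> (vir_bracket (\<phi> y) z + vir_bracket y (\<phi> z))"
begin

sublocale phi: Vector_Spaces.linear vir_scale vir_scale \<phi>
  by (rule linear)

abbreviation a :: "int \<Rightarrow> int \<Rightarrow> complex"
  where "a i n \<equiv> Poly_Mapping.lookup (\<phi> (vir_L i)) (Ind_L n)"

abbreviation c :: "int \<Rightarrow> complex"
  where "c i \<equiv> Poly_Mapping.lookup (\<phi> (vir_L i)) Ind_C"

abbreviation cC :: complex
  where "cC \<equiv> Poly_Mapping.lookup (\<phi> vir_C) Ind_C"

text \<open>Since \<open>vir_C\<close> is central and \<delta> is nonzero, its image commutes with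
  every \<open>vir_L j\<close>. The index \<open>n + 1\<close> makes the coefficient in
  \<open>lookup_bracket_L\<close> equal to -1 for all \<open>n\<close>.\<close>

lemma image_C_central: "Poly_Mapping.lookup (\<phi> vir_C) (Ind_L n) = 0"
proof -
  have "vir_scale \<delta> (vir_bracket (\<phi> vir_C) (vir_L (n + 1))) = 0"
    using leibniz[of vir_C "vir_L (n + 1)"] by (simp add: phi.zero)
  then have "\<delta> * Poly_Mapping.lookup (vir_bracket (\<phi> vir_C) (vir_L (n + 1))) (Ind_L (2 * n + 1)) = 0"
    by (metis lookup_vir_scale lookup_zero)
  then show ?thesis using nonzero by (simp add: lookup_bracket_L)
qed

lemma leibniz_L:
  "vir_scale (of_int (i - j)) (\<phi> (vir_L (i + j)))
     + vir_scale (if i + j = 0 then of_int (i ^ 3 - i) else 0) (\<phi> vir_C)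
   = vir_scale \<delta> (vir_bracket (\<phi> (vir_L i)) (vir_L j) - vir_bracket (\<phi> (vir_L j)) (vir_L i))"
proof -
  have "\<phi> (vir_bracket (vir_L i) (vir_L j))
      = vir_scale \<delta> (vir_bracket (\<phi> (vir_L i)) (vir_L j) - vir_bracket (\<phi> (vir_L j)) (vir_L i))"
    using leibniz[of "vir_L i" "vir_L j"] vir_bracket_antisym[of "vir_L i" "\<phi> (vir_L j)"]
    by (simp only: add_uminus_conv_diff)
  then show ?thesis
    by (simp only: vir_bracket_L_L phi.add phi.scale)
qed

lemma homogeneous: "homogeneous_component \<delta> k (\<lambda>i. a i (i + k))"
proof
  fix i j :: int
  have "of_int (i - j) * a (i + j) (i + j + k)
      = \<delta> * (of_int (i + j + k - 2 * j) * a i (i + j + k - j)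
           - of_int (i + j + k - 2 * i) * a j (i + j + k - i))"
    using arg_cong[OF leibniz_L[of i j], of "\<lambda>x. Poly_Mapping.lookup x (Ind_L (i + j + k))"]
    by (simp only: lookup_add lookup_vir_scale lookup_minus image_C_central lookup_bracket_L) simp
  then show "of_int (i - j) * a (i + j) (i + j + k)
      = \<delta> * (of_int (i - j + k) * a i (i + k) + of_int (i - j - k) * a j (j + k))"
    by (simp add: algebra_simps)
qed

lemma central_eq:
  "of_int (i - j) * c (i + j) + (if i + j = 0 then of_int (i ^ 3 - i) else 0) * cC
   = \<delta> * (of_int (i ^ 3 - i) * a j (- i) - of_int (j ^ 3 - j) * a i (- j))"
  using arg_cong[OF leibniz_L[of i j], of "\<lambda>x. Poly_Mapping.lookup x Ind_C"]
  by (simp only: lookup_add lookup_vir_scale lookup_minus lookup_bracket_C mult_minus_left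
      minus_diff_minus minus_diff_eq)

lemma scalarI:
  assumes "\<And>k. \<phi> (vir_basis k) = vir_scale t (vir_basis k)"
  shows "\<phi> x = vir_scale t x"
proof (induction x rule: vir_induct)
  case (scale s x)
  then show ?case by (simp add: phi.scale mult.commute)
qed (simp_all add: assms phi.add vir.scale_right_distrib)

text \<open>The central coordinates follow from \<open>central_eq\<close>: (1, -1) and (n, 0) give
  \<open>c = 0\<close>, and (2, -2) gives \<open>cC = 2 * \<delta> * t\<close>, which equals
  \<open>t\<close> under the second assumption.\<close>

lemma scalar_if_diagonal:
  assumes a: "\<And>i n. a i n = (if n = i then t else 0)" and t: "t = 0 \<or> \<delta> = 1 / 2"
  shows "\<phi> x = vir_scale t x"
proof (rule scalarI)
  have c: "c n = 0" for n
  proof (cases "n = 0")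
    case True
    then show ?thesis using central_eq[of 1 "- 1"] by simp
  next
    case False
    then show ?thesis using central_eq[of n 0] by (simp add: a)
  qed
  have cC: "cC = t"
    using central_eq[of 2 "- 2"] t by (auto simp: a c mult.commute[of _ 2])
  fix k
  show "\<phi> (vir_basis k) = vir_scale t (vir_basis k)"
    by (cases k) (auto intro!: vir_eqI simp: a c cC image_C_central lookup_vir_basis)
qed

lemma eq_zero:
  assumes "\<delta> \<noteq> 1" "\<delta> \<noteq> 1 / 2"
  shows "\<phi> x = 0"
proof -
  have "a i n = 0" for i n
    using homogeneous_component.eq_zero[OF homogeneous assms, of i "n - i"] by simp
  then show ?thesis using scalar_if_diagonal[of 0] by simp
qed

lemma scalar_of_half:
  assumes "\<delta> = 1 / 2"
  shows "\<exists>t. \<forall>x. \<phi> x = vir_scale t x"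
proof -
  have const: "a i (i + k) = a 0 k" for i k
    using homogeneous_component.const_of_half[OF homogeneous assms, of i k] by simp
  have a: "a i n = a 0 (n - i)" for i n
    using const[of i "n - i"] by simp
  have "a 0 k = 0" if "k \<noteq> 0" for k
  proof -
    define K where "K = (of_int k :: complex)"
    have K: "K \<noteq> 0" using that by (simp add: K_def)
    have shift: "a (- k) 0 = a 0 k" "a (- 2 * k) (- k) = a 0 k" "a k (2 * k) = a 0 k"
      using a[of "- k" 0] a[of "- 2 * k" "- k"] a[of k "2 * k"] by simp_all
    \<comment> \<open>two pairs of indices with sum \<open>- k\<close> give independent equations\<close>
    have "K * c (- k) = 1 / 2 * ((K ^ 3 - K) * a 0 k)"
      using central_eq[of 0 "- k"] that by (simp add: assms K_def algebra_simps)
    moreover have "3 * K * c (- k) = 1 / 2 * ((K ^ 3 - K) * a 0 k + (8 * K ^ 3 - 2 * K) * a 0 k)"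
      using central_eq[of k "- 2 * k"] that shift
      by (simp add: assms K_def power_mult_distrib algebra_simps)
    \<comment> \<open>Subtracting three times the first equation cancels the linear part of the
      cocycle and leaves the cubic one.\<close>
    ultimately have "K ^ 3 * a 0 k = 0" by algebra
    with K show ?thesis by simp
  qed
  then have "a i n = (if n = i then a 0 0 else 0)" for i n
    using a[of i n] by simp
  with assms show ?thesis using scalar_if_diagonal by blast
qed

end

section \<open>Commutative multiplications by derivations up to a scalar\<close>

text \<open>If \<open>mult x y\<close> is \<open>F x\<close> times \<open>y\<close>, commutativity
  contradicts the independence of \<open>x\<close> and \<open>y\<close> unless \<open>F\<close>
  vanishes.\<close>

lemma mult_half_eq_0:
  assumes "\<And>x. \<exists>t. \<forall>y. mult x y = vir_scale t y" and comm: "\<And>x y. mult x y = mult y x"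
  shows "mult x y = 0"
proof -
  obtain F where F: "mult x y = vir_scale (F x) y" for x y
    using assms(1) by metis
  have "Poly_Mapping.lookup (mult (vir_L 1) vir_C) Ind_C
      = Poly_Mapping.lookup (mult vir_C (vir_L 1)) Ind_C"
    by (simp only: comm)
  then have F1: "F (vir_L 1) = 0" by (simp add: F lookup_vir_basis)
  have "vir_scale (F x) (vir_L 1) = vir_scale (F (vir_L 1)) x"
    using comm by (simp only: F[symmetric])
  then have "vir_scale (F x) (vir_L 1) = 0" by (simp add: F1)
  then have "F x * Poly_Mapping.lookup (vir_L 1) (Ind_L 1) = 0"
    by (metis lookup_vir_scale lookup_zero)
  then have "F x = 0" by (simp add: lookup_vir_basis)
  then show ?thesis by (simp add: F)
qed

lemma mult_derivation_eq_0:
  assumes der: "\<And>x. vir_delta_derivation 1 (mult x)" and comm: "\<And>x y. mult x y = mult y x"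
  shows "mult x y = 0"
proof -
  define M where "M p i n = Poly_Mapping.lookup (mult (vir_L p) (vir_L i)) (Ind_L n)" for p i n
  have "\<exists>u. \<forall>i. M p i (i + k) = of_int (k - i) * u" for p k
    unfolding M_def
    by (rule homogeneous_component.inner_of_one[OF vir_delta_derivation.homogeneous[OF der] refl])
  then obtain u where u: "M p i (i + k) = of_int (k - i) * u p k" for p i k
    by metis
  have M: "M p i n = of_int (n - 2 * i) * u p (n - i)" for p i n
    using u[of p i "n - i"] by simp
  have sym: "M p i n = M i p n" for p i n
    by (simp only: M_def comm)
  \<comment> \<open>At \<open>n = 2 * i\<close> the factor \<open>n - 2 * i\<close> kills one side
    of the symmetry.\<close>
  have off: "u i k = 0" if "k \<noteq> i" for i k
    using sym[of "2 * i - k" i "2 * i"] that by (simp add: M)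
  have diag: "u i i = - u p p" if "i \<noteq> p" for i p
  proof -
    have "of_int (p - i) * u p p = of_int (i - p) * u i i"
      using sym[of p i "p + i"] by (simp add: M)
    then have "of_int (p - i) * (u p p + u i i) = 0" by (simp add: algebra_simps)
    with that have "u p p + u i i = 0" by (simp del: of_int_diff)
    then show ?thesis by (simp add: add_eq_0_iff)
  qed
  \<comment> \<open>Three numbers that are pairwise opposite are all zero.\<close>
  have "u i i = 0" for i
    using diag[of i "i + 1"] diag[of i "i + 2"] diag[of "i + 1" "i + 2"] by simp
  with off have "u i k = 0" for i k by (cases "k = i") auto
  then have "M p i n = 0" for p i n by (simp add: M)
  then have LL: "mult (vir_L p) y = 0" for p y
    using vir_delta_derivation.scalar_if_diagonal[OF der, of "vir_L p" 0]
    by (simp add: M_def)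
  \<comment> \<open>By commutativity \<open>mult x\<close> kills every \<open>vir_L i\<close>, so it
    is diagonal with \<open>t = 0\<close>; this also covers \<open>vir_C\<close>.\<close>
  have "mult x y = vir_scale 0 y"
    by (rule vir_delta_derivation.scalar_if_diagonal[OF der])
      (simp_all add: comm[of x] LL)
  then show ?thesis by simp
qed

lemma L_eq_bracket: "\<exists>y z s. vir_L n = vir_scale s (vir_bracket y z)"
proof (cases "n = 0")
  case True
  then have "vir_L n = vir_scale (1 / 2) (vir_bracket (vir_L 1) (vir_L (- 1)))"
    by (simp add: vir_bracket_L_L)
  then show ?thesis by blast
next
  case False
  then have "vir_L n = vir_scale (1 / of_int n) (vir_bracket (vir_L n) (vir_L 0))"
    by (simp add: vir_bracket_L_L)
  then show ?thesis by blast
qed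

text \<open>Perfectness of the algebra, for the case \<delta> = 0: brackets yield each
  \<open>vir_L n\<close>, and then \<open>vir_C\<close> from [L_2, L_{-2}] = 4 L_0 + 6 C.\<close>

lemma linear_eq_0_if_brackets:
  assumes "Vector_Spaces.linear vir_scale vir_scale \<phi>"
    and br: "\<And>y z. \<phi> (vir_bracket y z) = 0"
  shows "\<phi> x = 0"
proof -
  interpret phi: Vector_Spaces.linear vir_scale vir_scale \<phi> by (rule assms)
  have L: "\<phi> (vir_L n) = 0" for n
    using L_eq_bracket[of n] by (auto simp: phi.scale br)
  have "\<phi> (vir_bracket (vir_L 2) (vir_L (- 2))) = vir_scale 6 (\<phi> vir_C)"
    by (simp add: vir_bracket_L_L phi.add phi.scale L)
  then have "\<phi> vir_C = 0" by (simp add: br)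
  with L have "\<phi> (vir_basis k) = 0" for k by (cases k) auto
  then show ?thesis
    by (induction x rule: vir_induct) (simp_all add: phi.zero phi.add phi.scale)
qed

theorem corollary17:
  fixes \<delta> :: complex
  shows "\<not> (\<exists>mult. nontrivial_transposed_poisson_structure \<delta> vir_scale vir_bracket mult)"
proof
  assume "\<exists>mult. nontrivial_transposed_poisson_structure \<delta> vir_scale vir_bracket mult"
  then obtain mult where P: "transposed_poisson_algebra \<delta> vir_scale mult vir_bracket"
    and nontrivial: "\<exists>x y. mult x y \<noteq> 0"
    unfolding nontrivial_transposed_poisson_structure_def by blast
  interpret transposed_poisson_algebra \<delta> vir_scale mult vir_bracket by (rule P)
  have der: "vir_delta_derivation \<delta> (mult x)" if "\<delta> \<noteq> 0" for x
    by (rule vir_delta_derivation.intro) (fact that linear_right transposed_leibniz)+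
  consider "\<delta> = 0" | "\<delta> = 1" | "\<delta> = 1 / 2" | "\<delta> \<noteq> 0" "\<delta> \<noteq> 1" "\<delta> \<noteq> 1 / 2" by blast
  then have "mult x y = 0" for x y
  proof cases
    case 1
    then have "mult x (vir_bracket y z) = 0" for y z by (simp only: transposed_leibniz) simp
    then show ?thesis using linear_right by (rule linear_eq_0_if_brackets[rotated])
  next
    case 2
    then have "vir_delta_derivation 1 (mult x)" for x using der by simp
    then show ?thesis using mult_commute by (rule mult_derivation_eq_0)
  next
    case 3
    then have "\<exists>t. \<forall>y. mult x y = vir_scale t y" for x
      using vir_delta_derivation.scalar_of_half[OF der] by simp
    then show ?thesis using mult_commute by (rule mult_half_eq_0)
  next
    case 4
    then show ?thesis using vir_delta_derivation.eq_zero[OF der] by simp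
  qed
  with nontrivial show False by simp
qed

end
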